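(* Let $\mathcal{H}$ be an infinite-dimensional separable complex Hilbert space, let $V \in \mathcal{B}(\mathcal{H})$ be an isometry, and let $f, g \in \mathcal{H}$. Then $V + f \otimes g$ is not left-invertible if and only if \[ \|V^* f\| = \|f\| \quad \text{and} \quad \langle V^*f , g\rangle = -1. \]
   Context: $\mathcal{B}(\mathcal{H})$ is the algebra of bounded linear operators on $\mathcal{H}$. Inner products are linear in the first variable. For $f,g\in\mathcal{H}$, $(f \otimes g)h = \langle h, g\rangle f$ for $h \in \mathcal{H}$. An isometry is an operator $V$ with $V^*V = I_{\mathcal{H}}$. An operator $T \in \mathcal{B}(\mathcal{H})$ is left-invertible if there exists $S \in \mathcal{B}(\mathcal{H})$ with $ST = I_{\mathcal{H}}$. *)

theory Defs
  imports "HOL-Analysis.Analysis"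
begin

text \<open>
  HOL-Analysis has real inner product spaces only.  A complex Hilbert space is presented here as
  a complete real inner product space with a compatible complex scalar multiplication and a
  complex inner product, linear in its first argument, whose real part is the real inner product.
  In particular the norm, metric and topology are those of the complex inner product
  (see \<open>cinner_self\<close> and \<open>norm_eq_sqrt_cinner\<close> below).
\<close>

class complex_hilbert_space = real_inner + complete_space +
  fixes scaleC :: "complex \<Rightarrow> 'a \<Rightarrow> 'a" (infixr "*\<^sub>C" 75)
    and cinner :: "'a \<Rightarrow> 'a \<Rightarrow> complex"
  assumes scaleC_add_right: "c *\<^sub>C (x + y) = c *\<^sub>C x + c *\<^sub>C y"
    and scaleC_add_left: "(c + d) *\<^sub>C x = c *\<^sub>C x + d *\<^sub>C x"
    and scaleC_scaleC: "c *\<^sub>C (d *\<^sub>C x) = (c * d) *\<^sub>C x"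
    and scaleC_of_real: "of_real r *\<^sub>C x = r *\<^sub>R x"
    and cinner_add_left: "cinner (x + y) z = cinner x z + cinner y z"
    and cinner_scaleC_left: "cinner (c *\<^sub>C x) y = c * cinner x y"
    and cinner_commute: "cinner y x = cnj (cinner x y)"
    and Re_cinner: "Re (cinner x y) = inner x y"

lemma cinner_self: "cinner x x = of_real ((norm x)\<^sup>2)"
  for x :: "'a :: complex_hilbert_space"
proof (rule complex_eqI)
  show "Re (cinner x x) = Re (of_real ((norm x)\<^sup>2))"
    by (simp add: Re_cinner power2_norm_eq_inner)
  have "Im (cinner x x) = - Im (cinner x x)"
    by (subst cinner_commute) simp
  then show "Im (cinner x x) = Im (of_real ((norm x)\<^sup>2))"
    by simp
qed

lemma norm_eq_sqrt_cinner: "norm x = sqrt (cmod (cinner x x))"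
  for x :: "'a :: complex_hilbert_space"
  by (simp add: cinner_self norm_power)

lemma vector_space_scaleC:
  "vector_space (scaleC :: complex \<Rightarrow> 'a \<Rightarrow> 'a :: complex_hilbert_space)"
proof
  show "1 *\<^sub>C x = x" for x :: 'a
    using scaleC_of_real[of 1 x] by simp
qed (simp_all add: scaleC_add_right scaleC_add_left scaleC_scaleC)

definition infinite_dimensional :: "'a :: complex_hilbert_space itself \<Rightarrow> bool" where
  "infinite_dimensional _ \<longleftrightarrow>
     \<not> (\<exists>B :: 'a set. finite B \<and> module.span scaleC B = UNIV)"

definition bounded_clinear ::
    "('a :: complex_hilbert_space \<Rightarrow> 'b :: complex_hilbert_space) \<Rightarrow> bool" where
  "bounded_clinear T \<longleftrightarrow> bounded_linear T \<and> (\<forall>c x. T (c *\<^sub>C x) = c *\<^sub>C T x)"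

definition cadjoint ::
    "('a :: complex_hilbert_space \<Rightarrow> 'b :: complex_hilbert_space) \<Rightarrow> 'b \<Rightarrow> 'a" where
  "cadjoint T = (THE S. bounded_clinear S \<and> (\<forall>x y. cinner (T x) y = cinner x (S y)))"

text \<open>The description defining \<open>cadjoint\<close> is proper: uniqueness is immediate, existence is the
  Riesz representation theorem.\<close>

lemma cinner_eq_imp_eq:
  fixes a b :: "'a :: complex_hilbert_space"
  assumes "\<And>x. cinner x a = cinner x b"
  shows "a = b"
proof -
  have "inner x (a - b) = 0" for x
    using arg_cong[OF assms[of x], of Re] by (simp add: Re_cinner inner_diff_right)
  from this[of "a - b"] show ?thesis by simp
qed

lemma cinner_add_right: "cinner x (y + z) = cinner x y + cinner x z"
  for x :: "'a :: complex_hilbert_space"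
proof -
  have "cinner x (y + z) = cnj (cinner y x + cinner z x)"
    by (subst cinner_commute) (simp only: cinner_add_left)
  then show ?thesis by (simp add: cinner_commute[of y x] cinner_commute[of z x])
qed

lemma cinner_scaleC_right: "cinner x (c *\<^sub>C y) = cnj c * cinner x y"
  for x :: "'a :: complex_hilbert_space"
proof -
  have "cinner x (c *\<^sub>C y) = cnj (c * cinner y x)"
    by (subst cinner_commute) (simp only: cinner_scaleC_left)
  then show ?thesis by (simp add: cinner_commute[of y x])
qed

lemma inner_i_right: "inner x (\<i> *\<^sub>C y) = - inner (\<i> *\<^sub>C x) y"
  for x :: "'a :: complex_hilbert_space"
  by (simp add: Re_cinner[symmetric] cinner_scaleC_left cinner_scaleC_right)

lemma cinner_eq_inner: "cinner x y = Complex (inner x y) (inner x (\<i> *\<^sub>C y))"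
  for x :: "'a :: complex_hilbert_space"
  by (rule complex_eqI) (simp_all add: Re_cinner[symmetric] cinner_scaleC_right)

lemma riesz_real:
  fixes \<phi> :: "'a :: {real_inner, complete_space} \<Rightarrow> real"
  assumes "bounded_linear \<phi>"
  shows "\<exists>z. \<forall>x. \<phi> x = inner x z"
proof -
  interpret bounded_linear \<phi> by fact
  define F where "F x = (norm x)\<^sup>2 - 2 * \<phi> x" for x
  obtain K where K: "\<And>x. norm (\<phi> x) \<le> norm x * K"
    using bounded by blast
  have lower: "- K\<^sup>2 \<le> F x" for x
  proof -
    have "\<phi> x \<le> norm x * K" using K[of x] by simp
    moreover have "0 \<le> (norm x - K)\<^sup>2" by simp
    ultimately show ?thesis unfolding F_def
      by (simp add: power2_eq_square algebra_simps)
  qed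
  define m where "m = Inf (range F)"
  have bdd: "bdd_below (range F)" using lower by (auto intro!: bdd_belowI[of _ "- K\<^sup>2"])
  have m_le: "m \<le> F x" for x
    unfolding m_def using bdd by (intro cInf_lower) auto
  have "\<exists>x. F x < m + inverse (real (Suc n))" for n
    using cInf_lessD[of "range F" "m + inverse (real (Suc n))"] by (auto simp: m_def)
  then obtain u where u: "\<And>n. F (u n) < m + inverse (real (Suc n))" by metis
  have par: "(norm (x - y))\<^sup>2 \<le> 2 * (F x - m) + 2 * (F y - m)" for x y
  proof -
    let ?w = "(1/2) *\<^sub>R (x + y)"
    have "m \<le> F ?w" by (rule m_le)
    moreover have "F ?w = (1/4) * (norm (x + y))\<^sup>2 - \<phi> x - \<phi> y"
      by (simp add: F_def scaleR add power_divide add_divide_distrib del: scaleR_add_right)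
    moreover have "(norm (x - y))\<^sup>2 + (norm (x + y))\<^sup>2 = 2 * (norm x)\<^sup>2 + 2 * (norm y)\<^sup>2"
      by (simp add: power2_norm_eq_inner algebra_simps)
    ultimately show ?thesis by (simp add: F_def)
  qed
  have "Cauchy u"
  proof (rule metric_CauchyI)
    fix e :: real assume e: "e > 0"
    then obtain N where N: "inverse (real (Suc N)) < e\<^sup>2 / 4"
      using reals_Archimedean[of "e\<^sup>2 / 4"] by auto
    have close: "F (u i) < m + e\<^sup>2 / 4" if "N \<le> i" for i
    proof -
      have "inverse (real (Suc i)) \<le> inverse (real (Suc N))"
        using that by (intro le_imp_inverse_le) simp_all
      then show ?thesis using u[of i] N by (meson add_strict_left_mono le_less_trans less_trans)
    qed
    show "\<exists>M. \<forall>i\<ge>M. \<forall>j\<ge>M. dist (u i) (u j) < e"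
    proof (intro exI allI impI)
      fix i j assume "N \<le> i" "N \<le> j"
      then have "(norm (u i - u j))\<^sup>2 < e\<^sup>2"
        using par[of "u i" "u j"] close[of i] close[of j] by argo
      then show "dist (u i) (u j) < e"
        using e by (simp add: dist_norm power_less_imp_less_base)
    qed
  qed
  then obtain z where z: "u \<longlonglongrightarrow> z" using Cauchy_convergent convergent_def by blast
  have "(\<lambda>n. F (u n)) \<longlonglongrightarrow> F z" unfolding F_def
    by (intro tendsto_intros z tendsto)
  moreover have "(\<lambda>n. m + inverse (real (Suc n))) \<longlonglongrightarrow> m + 0"
    by (intro tendsto_intros LIMSEQ_inverse_real_of_nat)
  ultimately have "F z \<le> m + 0"
    by (rule LIMSEQ_le) (use u less_imp_le in blast)
  then have Fz: "F z \<le> F x" for x using m_le[of x] by simp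
  have "\<phi> x = inner x z" for x
  proof (rule ccontr)
    assume ne: "\<phi> x \<noteq> inner x z"
    define d where "d = \<phi> x - inner x z"
    have *: "0 \<le> t\<^sup>2 * inner x x - 2 * t * d" for t
    proof -
      have "(norm (z + t *\<^sub>R x))\<^sup>2 = (norm z)\<^sup>2 + 2 * t * inner x z + t\<^sup>2 * inner x x"
        unfolding power2_norm_eq_inner
        by (simp add: power2_eq_square inner_add_left inner_add_right inner_commute algebra_simps)
      then show ?thesis
        using Fz[of "z + t *\<^sub>R x"] by (simp add: F_def d_def add scaleR algebra_simps)
    qed
    define s where "s = inner x x + 1"
    have s: "s > 0" by (simp add: s_def add_nonneg_pos)
    define k where "k = d / s"
    have d: "d = k * s" and xx: "inner x x = s - 1" using s by (simp_all add: k_def s_def)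
    have "k\<^sup>2 * inner x x - 2 * k * d = - (k\<^sup>2 * (s + 1))"
      by (simp add: d xx power2_eq_square algebra_simps)
    moreover have "k\<^sup>2 * (s + 1) > 0" using ne s by (simp add: k_def d_def)
    ultimately show False using *[of k] by linarith
  qed
  then show ?thesis by blast
qed

lemma cadjoint_exists:
  fixes T :: "'a :: complex_hilbert_space \<Rightarrow> 'b :: complex_hilbert_space"
  assumes "bounded_clinear T"
  shows "\<exists>!S. bounded_clinear S \<and> (\<forall>x y. cinner (T x) y = cinner x (S y))"
proof -
  interpret T: bounded_linear T using assms by (simp add: bounded_clinear_def)
  have Tc: "T (c *\<^sub>C x) = c *\<^sub>C T x" for c x using assms by (simp add: bounded_clinear_def)
  have "\<exists>z. \<forall>x. inner (T x) y = inner x z" for y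
    by (rule riesz_real)
      (rule bounded_linear_compose[OF bounded_linear_inner_left T.bounded_linear_axioms])
  then obtain S where S: "\<And>x y. inner (T x) y = inner x (S y)" by metis
  have adj: "cinner (T x) y = cinner x (S y)" for x y
    using S[of x y] S[of "\<i> *\<^sub>C x" y] by (simp add: cinner_eq_inner inner_i_right Tc)
  have Sadd: "S (y + y') = S y + S y'" for y y'
    by (rule cinner_eq_imp_eq) (simp add: adj[symmetric] cinner_add_right)
  have Sscale: "S (c *\<^sub>C y) = c *\<^sub>C S y" for c y
    by (rule cinner_eq_imp_eq) (simp add: adj[symmetric] cinner_scaleC_right)
  obtain K where K: "K \<ge> 0" "\<And>x. norm (T x) \<le> norm x * K"
    using T.nonneg_bounded by blast
  have Sbound: "norm (S y) \<le> norm y * K" for y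
  proof (cases "S y = 0")
    case True
    then show ?thesis using K(1) by simp
  next
    case False
    have "norm (S y) * norm (S y) = inner (T (S y)) y"
      by (simp add: S dot_square_norm power2_eq_square)
    also have "\<dots> \<le> norm (T (S y)) * norm y" by (rule norm_cauchy_schwarz)
    also have "\<dots> \<le> (norm (S y) * K) * norm y" by (intro mult_right_mono K) simp
    finally have "norm (S y) * norm (S y) \<le> norm (S y) * (norm y * K)"
      by (simp add: ac_simps)
    then show ?thesis using False by simp
  qed
  have "bounded_linear S"
  proof (rule bounded_linear_intro)
    show "S (y + y') = S y + S y'" for y y' by (rule Sadd)
    show "S (r *\<^sub>R y) = r *\<^sub>R S y" for r y
      using Sscale[of "of_real r" y] by (simp add: scaleC_of_real)
  qed (rule Sbound)
  then have "bounded_clinear S \<and> (\<forall>x y. cinner (T x) y = cinner x (S y))"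
    using Sscale adj by (simp add: bounded_clinear_def)
  moreover have "S' = S" if "\<forall>x y. cinner (T x) y = cinner x (S' y)" for S'
    using that adj by (metis cinner_eq_imp_eq ext)
  ultimately show ?thesis by blast
qed

definition is_isometry :: "('a :: complex_hilbert_space \<Rightarrow> 'a) \<Rightarrow> bool" where
  "is_isometry V \<longleftrightarrow> bounded_clinear V \<and> cadjoint V \<circ> V = id"

definition left_invertible :: "('a :: complex_hilbert_space \<Rightarrow> 'a) \<Rightarrow> bool" where
  "left_invertible T \<longleftrightarrow> (\<exists>S. bounded_clinear S \<and> S \<circ> T = id)"

definition rank_one :: "'a \<Rightarrow> 'a \<Rightarrow> 'a \<Rightarrow> 'a :: complex_hilbert_space" (infix "\<otimes>" 72) where
  "f \<otimes> g = (\<lambda>h. cinner h g *\<^sub>C f)"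

end

theory Submission
  imports Defs
begin

text \<open>Put \<open>a = V\<^sup>* f\<close> and let \<open>p = f - V a\<close> be the component of \<open>f\<close> orthogonal to the range of \<open>V\<close>;
  then \<open>p = 0\<close> iff \<open>\<parallel>a\<parallel> = \<parallel>f\<parallel>\<close>. If \<open>p = 0\<close> and \<open>\<langle>a, g\<rangle> = -1\<close>, the nonzero vector \<open>a\<close> lies in
  the kernel of \<open>V + f \<otimes> g\<close>. In every other case a left inverse has the form \<open>V\<^sup>* + u \<otimes> v\<close>,
  with \<open>v = p\<close> if \<open>p \<noteq> 0\<close> and \<open>v = V g\<close> if \<open>\<langle>a, g\<rangle> \<noteq> -1\<close>.\<close>

interpretation scaleC: vector_space
  "scaleC :: complex \<Rightarrow> 'a \<Rightarrow> 'a :: complex_hilbert_space"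
  by (rule vector_space_scaleC)

lemma bounded_clinear_cadjoint: "bounded_clinear T \<Longrightarrow> bounded_clinear (cadjoint T)"
  and cinner_cadjoint: "bounded_clinear T \<Longrightarrow> cinner (T x) y = cinner x (cadjoint T y)"
  using theI'[OF cadjoint_exists[of T]] unfolding cadjoint_def[symmetric] by blast+

lemma cinner_cadjoint_left: "bounded_clinear T \<Longrightarrow> cinner (cadjoint T y) x = cinner y (T x)"
  by (metis cinner_cadjoint cinner_commute)

lemma cinner_diff_left: "cinner (x - y) z = cinner x z - cinner y z"
  for x :: "'a :: complex_hilbert_space"
  using cinner_add_left[of "x - y" y z] by simp

lemma cinner_diff_right: "cinner x (y - z) = cinner x y - cinner x z"
  for x :: "'a :: complex_hilbert_space"
  using cinner_add_right[of x "y - z" z] by simp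

text \<open>Splitting \<open>cinner h g\<close> into real and imaginary parts turns the operator
  into a sum of two real rank-one maps, whose boundedness is standard.\<close>

lemma bounded_clinear_rank_one: "bounded_clinear (f \<otimes> g)"
proof -
  have "f \<otimes> g = (\<lambda>h. inner h g *\<^sub>R f + inner h (\<i> *\<^sub>C g) *\<^sub>R (\<i> *\<^sub>C f))"
  proof
    fix h
    have "cinner h g = of_real (inner h g) + of_real (inner h (\<i> *\<^sub>C g)) * \<i>"
      by (simp add: cinner_eq_inner complex_eq_iff)
    then show "(f \<otimes> g) h = inner h g *\<^sub>R f + inner h (\<i> *\<^sub>C g) *\<^sub>R (\<i> *\<^sub>C f)"
      unfolding rank_one_def
      by (simp only: scaleC_add_left scaleC_of_real flip: scaleC_scaleC)
  qed
  moreover have "bounded_linear (\<lambda>h. inner h g *\<^sub>R f + inner h (\<i> *\<^sub>C g) *\<^sub>R (\<i> *\<^sub>C f))"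
    by (intro bounded_linear_add bounded_linear_scaleR_const bounded_linear_inner_left)
  ultimately have "bounded_linear (f \<otimes> g)" by simp
  then show ?thesis
    by (simp add: bounded_clinear_def rank_one_def cinner_scaleC_left scaleC_scaleC)
qed

lemma bounded_clinear_add:
  "bounded_clinear S \<Longrightarrow> bounded_clinear T \<Longrightarrow> bounded_clinear (\<lambda>x. S x + T x)"
  by (simp add: bounded_clinear_def bounded_linear_add scaleC_add_right)

lemma cadjoint_isometry: "is_isometry V \<Longrightarrow> cadjoint V (V x) = x"
  by (metis comp_apply id_apply is_isometry_def)

text \<open>The residual is orthogonal to the range of \<open>V\<close>, so its squared norm is its
  inner product with \<open>f\<close>; moving \<open>V\<close> across as the adjoint
  finishes.\<close>

lemma isometry_pythagoras:
  assumes "is_isometry V"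
  shows "(norm (f - V (cadjoint V f)))\<^sup>2 = (norm f)\<^sup>2 - (norm (cadjoint V f))\<^sup>2"
proof -
  have V: "bounded_clinear V" using assms by (simp add: is_isometry_def)
  have "cinner (V x) (f - V (cadjoint V f)) = 0" for x
    by (simp add: cinner_diff_right cinner_cadjoint[OF V] cadjoint_isometry[OF assms])
  then have "cinner (f - V (cadjoint V f)) (f - V (cadjoint V f)) =
      cinner f f - cinner (cadjoint V f) (cadjoint V f)"
    by (simp only: cinner_diff_left[of f] diff_0_right)
      (simp only: cinner_diff_right flip: cinner_cadjoint_left[OF V])
  then show ?thesis
    by (simp only: cinner_self flip: of_real_diff) (simp only: of_real_eq_iff)
qed

text \<open>The assumption \<open>range\<close> means
  \<open>cadjoint V v = cnj d *\<^sub>C g\<close>. Pairing the image of \<open>h\<close> with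
  \<open>v\<close> thus recovers the coefficient \<open>cinner h g\<close> up to the nonzero factor
  \<open>d + cinner f v\<close>.\<close>

lemma left_invertible_isometry_perturbation:
  assumes V: "is_isometry V"
    and range: "\<And>h. cinner (V h) v = d * cinner h g"
    and nz: "d + cinner f v \<noteq> 0"
  shows "left_invertible (\<lambda>h. V h + (f \<otimes> g) h)"
proof -
  have bV: "bounded_clinear V" using V by (simp add: is_isometry_def)
  note bW = bounded_clinear_cadjoint[OF bV]
  then interpret W: bounded_linear "cadjoint V" by (simp add: bounded_clinear_def)
  define k where "k = d + cinner f v"
  \<comment> \<open>The adjoint sends the image of \<open>h\<close> to \<open>h\<close> plus
    \<open>cinner h g\<close> times \<open>cadjoint V f\<close>; \<open>u\<close> is scaled to
    cancel this excess.\<close>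
  define u where "u = (- (1 / k)) *\<^sub>C cadjoint V f"
  define S where "S = (\<lambda>y. cadjoint V y + (u \<otimes> v) y)"
  have "S (V h + (f \<otimes> g) h) = h" for h
  proof -
    have "cinner (V h + cinner h g *\<^sub>C f) v = cinner h g * k"
      by (simp add: cinner_add_left cinner_scaleC_left range k_def algebra_simps)
    moreover have "cadjoint V (V h + cinner h g *\<^sub>C f) = h + cinner h g *\<^sub>C cadjoint V f"
      using bW by (simp add: W.add cadjoint_isometry[OF V] bounded_clinear_def)
    ultimately show ?thesis
      using nz by (simp add: S_def rank_one_def u_def scaleC_scaleC flip: k_def)
  qed
  then have "S \<circ> (\<lambda>h. V h + (f \<otimes> g) h) = id" by (simp add: fun_eq_iff)
  moreover have "bounded_clinear S"
    unfolding S_def by (intro bounded_clinear_add bW bounded_clinear_rank_one)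
  ultimately show ?thesis unfolding left_invertible_def by blast
qed

theorem corollary1p2:
  fixes V :: "'a :: complex_hilbert_space \<Rightarrow> 'a" and f g :: 'a
  assumes "infinite_dimensional TYPE('a)"
    and "separable_space (euclidean :: 'a topology)"
    and "is_isometry V"
  shows "\<not> left_invertible (\<lambda>h. V h + (f \<otimes> g) h) \<longleftrightarrow>
           norm (cadjoint V f) = norm f \<and> cinner (cadjoint V f) g = - 1"
proof -
  note V = \<open>is_isometry V\<close>
  then have bV: "bounded_clinear V" by (simp add: is_isometry_def)
  define a where "a = cadjoint V f"
  define p where "p = f - V a"
  have p0: "p = 0 \<longleftrightarrow> norm a = norm f"
  proof -
    have "(norm p)\<^sup>2 = (norm f)\<^sup>2 - (norm a)\<^sup>2"
      using isometry_pythagoras[OF V] by (simp add: p_def a_def)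
    then have "p = 0 \<longleftrightarrow> (norm a)\<^sup>2 = (norm f)\<^sup>2" by auto
    then show ?thesis by simp
  qed
  have Vp: "cinner (V h) p = 0" for h
    by (simp add: cinner_diff_right cinner_cadjoint[OF bV] cadjoint_isometry[OF V] p_def a_def)
  have "left_invertible (\<lambda>h. V h + (f \<otimes> g) h)" if "p \<noteq> 0"
  proof (rule left_invertible_isometry_perturbation[OF V, of p 0])
    \<comment> \<open>Since \<open>p\<close> is orthogonal to \<open>V a\<close>, this is the
      squared norm of \<open>p\<close>.\<close>
    have "cinner f p = cinner (p + V a) p" by (simp add: p_def)
    also have "\<dots> = cinner p p" by (simp only: cinner_add_left Vp add_0_right)
    finally show "0 + cinner f p \<noteq> 0" using that by (simp add: cinner_self)
  qed (simp add: Vp)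
  moreover have "left_invertible (\<lambda>h. V h + (f \<otimes> g) h)" if "cinner a g \<noteq> - 1"
  proof (rule left_invertible_isometry_perturbation[OF V, of "V g" 1])
    \<comment> \<open>The isometry preserves inner products, hence \<open>d = 1\<close>; the adjoint
      turns \<open>cinner f (V g)\<close> into \<open>cinner a g\<close>.\<close>
    show "1 + cinner f (V g) \<noteq> 0"
      using that unfolding a_def cinner_cadjoint_left[OF bV] by (simp add: add_eq_0_iff)
  qed (simp add: cinner_cadjoint[OF bV] cadjoint_isometry[OF V])
  moreover have "\<not> left_invertible (\<lambda>h. V h + (f \<otimes> g) h)"
    if p: "p = 0" and ag: "cinner a g = - 1"
  proof
    assume "left_invertible (\<lambda>h. V h + (f \<otimes> g) h)"
    then obtain S where S: "bounded_clinear S" "\<And>h. S (V h + (f \<otimes> g) h) = h"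
      by (auto simp: left_invertible_def fun_eq_iff)
    \<comment> \<open>Here \<open>V a = f\<close>, while the rank-one term contributes
      \<open>- f\<close>.\<close>
    have "V a + (f \<otimes> g) a = 0"
      using p by (simp add: rank_one_def ag p_def)
    then have "a = S 0" using S(2)[of a] by simp
    also have "S 0 = 0" using S(1) by (simp add: bounded_clinear_def linear_simps(3))
    \<comment> \<open>The instance with \<open>g - g\<close> yields \<open>cinner 0 g = 0\<close>,
      contradicting the value \<open>- 1\<close>.\<close>
    finally show False using ag cinner_diff_left[of g g g] by simp
  qed
  ultimately show ?thesis unfolding p0 a_def[symmetric] by blast
qed

end
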